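(* Let $I$ be a nonempty finite set of nonnegative integers and let $n=\max I$. Let $k$ be the minimum nonnegative integer for which there exist integers $d_1\geq d_2\geq\cdots\geq d_k$ such that $$I\subseteq \{n\}\cup\bigcup_{m=1}^k \left\{ i\in \mathbb{Z}_+ : \sum_{j=1}^m d_j - (m-1)n\leq i\leq d_m\right\}.$$ Then the number of convex quadratic inequalities needed to represent a convex set with facial dimension signature $I$ cannot be smaller than $k$; that is, if a convex set $C$ in some $\mathbb{R}^N$ has facial dimension signature $I$ and is the solution set of a system of $K$ convex quadratic inequalities, then $K\geq k$.
   Context: $\mathbb{Z}_+$ denotes the set of nonnegative integers. A convex subset $F$ of a convex set $C$ is a face of $C$ if for any $x,y\in C$ whose open segment $(x,y)$ meets $F$ one has $x,y\in F$ (with the convention $(x,x)=\{x\}$). The dimension of a convex set is the dimension of the smallest affine subspace containing it. The facial dimension signature of $C$ is the set $\{\dim F : F \text{ a nonempty face of } C\}$. A convex quadratic inequality in $\mathbb{R}^N$ is an inequality $f(x)\le 0$ with $f(x)=\langle Ax,x\rangle+\langle a,x\rangle+\alpha$, where $A$ is a symmetric positive semidefinite $N\times N$ matrix (possibly zero), $a\in\mathbb{R}^N$, $\alpha\in\mathbb{R}$. The solution set of an empty system is the whole space; for $k=0$ the right-hand side of the displayed inclusion is $\{n\}$. *)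

theory Defs
  imports "HOL-Analysis.Analysis"
begin

(* Faces are those of the library's face_of.  Its open_segment is empty when the endpoints
   coincide; for such endpoints the convention (x,x) = {x} imposes no further condition,
   so both conventions give the same faces. *)
definition facial_dimension_signature :: "'a::euclidean_space set \<Rightarrow> int set" where
  "facial_dimension_signature C = {aff_dim F | F. F face_of C \<and> F \<noteq> {}}"

definition positive_semidefinite :: "real^'n^'n \<Rightarrow> bool" where
  "positive_semidefinite A \<longleftrightarrow> (\<forall>x. 0 \<le> (A *v x) \<bullet> x)"

definition convex_quadratic :: "(real^'n \<Rightarrow> real) \<Rightarrow> bool" where
  "convex_quadratic f \<longleftrightarrow>
     (\<exists>(A :: real^'n^'n) (a :: real^'n) (\<alpha> :: real).
        transpose A = A \<and> positive_semidefinite A \<and>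
        f = (\<lambda>x. (A *v x) \<bullet> x + a \<bullet> x + \<alpha>))"

(* The indices j < K number the inequalities; repetitions are allowed, and K = 0 gives the
   whole space. *)
definition represented_by_convex_quadratics :: "(real^'n) set \<Rightarrow> nat \<Rightarrow> bool" where
  "represented_by_convex_quadratics C K \<longleftrightarrow>
     (\<exists>f :: nat \<Rightarrow> real^'n \<Rightarrow> real.
        (\<forall>j<K. convex_quadratic (f j)) \<and> C = {x. \<forall>j<K. f j x \<le> 0})"

definition signature_block :: "nat \<Rightarrow> (nat \<Rightarrow> int) \<Rightarrow> nat \<Rightarrow> nat set" where
  "signature_block n d m =
     {i. (\<Sum>j=1..m. d j) - (int m - 1) * int n \<le> int i \<and> int i \<le> d m}"

definition coverable :: "nat set \<Rightarrow> nat \<Rightarrow> bool" where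
  "coverable I k \<longleftrightarrow>
     (\<exists>d :: nat \<Rightarrow> int. antimono_on {1..k} d \<and>
        I \<subseteq> {Max I} \<union> (\<Union>m\<in>{1..k}. signature_block (Max I) d m))"

definition min_cover :: "nat set \<Rightarrow> nat" where
  "min_cover I = (LEAST k. coverable I k)"

(* The minimum exists: k = n and d_m = n - m are always admissible. *)
lemma coverable_Max:
  assumes "finite I"
  shows "coverable I (Max I)"
proof -
  define n where "n = Max I"
  define d where "d m = int n - int m" for m
  have anti: "antimono_on {1..n} d"
    by (auto simp: monotone_on_def d_def)
  have "i \<in> signature_block n d (n - i)" if "i < n" for i
  proof -
    define m where "m = n - i"
    have m: "1 \<le> m" "d m = int i"
      using that by (auto simp: m_def d_def)
    have "(\<Sum>j=1..m. d j) = (\<Sum>j=1..<m. d j) + d m"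
      using m(1) by (simp add: sum.last_plus)
    also have "(\<Sum>j=1..<m. d j) \<le> (\<Sum>j=1..<m. int n)"
      by (rule sum_mono) (simp add: d_def)
    also have "\<dots> = (int m - 1) * int n"
      using m(1) by (simp add: of_nat_diff)
    finally show ?thesis
      using m by (simp add: signature_block_def flip: m_def)
  qed
  moreover have "i \<le> n" if "i \<in> I" for i
    using that assms by (simp add: n_def)
  ultimately have "I \<subseteq> {n} \<union> (\<Union>m\<in>{1..n}. signature_block n d m)"
    by (fastforce simp: le_less)
  with anti show ?thesis
    unfolding coverable_def n_def by blast
qed

lemma min_cover_least:
  assumes "finite I"
  shows "coverable I (min_cover I)" "coverable I k \<Longrightarrow> min_cover I \<le> k"
  unfolding min_cover_def using coverable_Max[OF assms] by (auto intro: LeastI Least_le)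

end

theory Submission
  imports Defs
begin

text \<open>
  The dimensions of faces are dimensions of intersections of \<open>K\<close> fixed subspaces. Along a
  segment in \<open>f \<le> 0\<close> with a zero of the convex quadratic \<open>f\<close> in its interior, \<open>f\<close> is convex with
  an interior maximum, so both derivatives along the segment vanish; for a quadratic, this forces
  \<open>f\<close> to be invariant under translation in that direction everywhere, not just at the given zero.
  So a relative interior point \<open>x\<close> of a face \<open>F\<close> determines the directions of \<open>F\<close> only through the
  set of constraints active at \<open>x\<close>: they are the directions common to the invariance spaces of
  those constraints (\<open>directions_face_eq\<close>).

  Let \<open>V\<close> be the direction space of \<open>C\<close>, of dimension \<open>n = Max I\<close>, and let \<open>d\<^sub>1 \<ge> \<dots> \<ge> d\<^sub>K\<close> be the
  dimensions of the intersections of \<open>V\<close> with the invariance spaces, in decreasing order.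
  If no constraint is active, \<open>F\<close> has dimension \<open>n\<close>. Otherwise let \<open>m\<close> be the largest
  active index. The dimension of \<open>F\<close> is at most \<open>d\<^sub>m\<close>, and since codimensions in \<open>V\<close> are
  subadditive under intersection, it is at least \<open>n - (n - d\<^sub>1) - \<dots> - (n - d\<^sub>m)\<close>. These are
  the bounds of the \<open>m\<close>-th block, so the \<open>d\<^sub>j\<close> cover \<open>I\<close>.
\<close>

section \<open>Direction spaces of affine hulls\<close>

text \<open>Defined without a base point, so that the direction spaces of a set and of its
  faces can be compared although they are computed at different points.\<close>
definition directions :: "'a::euclidean_space set \<Rightarrow> 'a set" where
  "directions S = {h. \<forall>y\<in>affine hull S. y + h \<in> affine hull S}"

lemma mem_directions_iff:
  assumes "a \<in> affine hull S"
  shows "h \<in> directions S \<longleftrightarrow> a + h \<in> affine hull S"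
proof -
  have "y + h \<in> affine hull S" if "a + h \<in> affine hull S" "y \<in> affine hull S" for y
    using mem_affine_3_minus[OF affine_affine_hull that(2) that(1) assms, of 1] by simp
  then show ?thesis
    using assms by (auto simp: directions_def)
qed

lemma directions_eq_image:
  assumes "a \<in> affine hull S"
  shows "directions S = (\<lambda>y. y - a) ` (affine hull S)"
proof (intro set_eqI iffI)
  fix h assume "h \<in> directions S"
  then have "a + h \<in> affine hull S"
    using mem_directions_iff[OF assms] by blast
  then show "h \<in> (\<lambda>y. y - a) ` (affine hull S)"
    by (rule rev_image_eqI) simp
next
  fix h assume "h \<in> (\<lambda>y. y - a) ` (affine hull S)"
  then obtain y where "y \<in> affine hull S" "h = y - a"
    by blast
  then have "a + h \<in> affine hull S"
    by simp
  then show "h \<in> directions S"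
    using mem_directions_iff[OF assms] by blast
qed

lemma subspace_directions:
  assumes "S \<noteq> {}"
  shows "subspace (directions S)"
proof -
  obtain a where a: "a \<in> affine hull S"
    using assms by (meson all_not_in_conv hull_inc)
  then show ?thesis
    unfolding directions_eq_image[OF a]
    using a by (intro affine_diffs_subspace_subtract affine_affine_hull)
qed

lemma aff_dim_eq_dim_directions:
  assumes "S \<noteq> {}"
  shows "aff_dim S = int (dim (directions S))"
proof -
  obtain a where a: "a \<in> affine hull S"
    using assms by (meson all_not_in_conv hull_inc)
  have "aff_dim (affine hull S) = int (dim ((\<lambda>y. y - a) ` (affine hull S)))"
    using a by (intro aff_dim_eq_dim_subtract) (simp add: hull_inc)
  then show ?thesis
    by (simp add: directions_eq_image[OF a])
qed

lemma rel_interior_both_sides: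
  fixes x h :: "'a::euclidean_space"
  assumes "x \<in> rel_interior S" "h \<in> directions S"
  obtains t where "t > 0" "x + t *\<^sub>R h \<in> S" "x - t *\<^sub>R h \<in> S"
proof -
  obtain e where e: "e > 0" "cball x e \<inter> affine hull S \<subseteq> S" and "x \<in> S"
    using assms(1) by (auto simp: mem_rel_interior_cball)
  then have x: "x \<in> affine hull S" and "S \<noteq> {}"
    by (auto simp: hull_inc)
  define t where "t = e / (norm h + 1)"
  have "t > 0"
    using e by (simp add: t_def add_nonneg_pos)
  have "norm (t *\<^sub>R h) \<le> e"
    using e by (simp add: t_def divide_simps add_nonneg_pos)
  have "s *\<^sub>R h \<in> directions S" for s
    using assms(2) subspace_directions[OF \<open>S \<noteq> {}\<close>] by (simp add: subspace_scale)
  then have "x + s *\<^sub>R h \<in> affine hull S" for s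
    using mem_directions_iff[OF x] by blast
  from this[of t] this[of "- t"] have "x + t *\<^sub>R h \<in> S" "x - t *\<^sub>R h \<in> S"
    using e(2) \<open>norm (t *\<^sub>R h) \<le> e\<close> by (auto simp: dist_norm subset_iff)
  with \<open>t > 0\<close> show thesis
    by (rule that)
qed

section \<open>Invariance spaces of convex quadratic functions\<close>

definition invariance_space :: "('a::real_vector \<Rightarrow> real) \<Rightarrow> 'a set" where
  "invariance_space f = {h. \<forall>x t. f (x + t *\<^sub>R h) = f x}"

lemma subspace_invariance_space: "subspace (invariance_space f)"
proof (rule subspaceI)
  show "0 \<in> invariance_space f"
    by (simp add: invariance_space_def)
next
  fix h k assume hk: "h \<in> invariance_space f" "k \<in> invariance_space f"
  have "f (x + t *\<^sub>R (h + k)) = f ((x + t *\<^sub>R h) + t *\<^sub>R k)" for x t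
    by (simp only: scaleR_add_right add.assoc)
  with hk show "h + k \<in> invariance_space f"
    by (simp add: invariance_space_def)
next
  fix c h assume "h \<in> invariance_space f"
  then show "c *\<^sub>R h \<in> invariance_space f"
    by (simp add: invariance_space_def)
qed

lemma positive_semidefinite_kernel:
  fixes A :: "real^'n^'n"
  assumes sym: "transpose A = A" and psd: "positive_semidefinite A" and 0: "(A *v h) \<bullet> h = 0"
  shows "A *v h = 0"
proof (rule ccontr)
  assume "A *v h \<noteq> 0"
  define v where "v = A *v h"
  define c where "c = (A *v v) \<bullet> v"
  have v: "v \<bullet> v > 0"
    using \<open>A *v h \<noteq> 0\<close> by (simp add: v_def)
  have c: "c \<ge> 0"
    using psd by (simp add: c_def positive_semidefinite_def)
  (* The quadratic form along h + t v is 2 t |v|^2 + t^2 c, negative for small t < 0; this t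
     is small enough for every c, including c = 0. *)
  define t where "t = - (v \<bullet> v) / (c + 1)"
  have "(A *v v) \<bullet> h = v \<bullet> v"
    using sym by (metis dot_lmul_matrix inner_commute transpose_matrix_vector v_def)
  then have "(A *v (h + t *\<^sub>R v)) \<bullet> (h + t *\<^sub>R v) = 2 * t * (v \<bullet> v) + t\<^sup>2 * c"
    using 0 by (simp add: matrix_vector_right_distrib matrix_vector_mult_scaleR inner_add_left
        inner_add_right c_def power2_eq_square algebra_simps flip: v_def)
  also have "\<dots> = - ((v \<bullet> v)\<^sup>2 * (c + 2) / (c + 1)\<^sup>2)"
    using c by (simp add: t_def divide_simps power2_eq_square) (simp add: algebra_simps)
  also have "\<dots> < 0"
    using v c by simp
  finally show False
    using psd by (simp add: positive_semidefinite_def not_less[symmetric])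
qed

lemma convex_quadratic_continuous:
  fixes f :: "real^'n \<Rightarrow> real"
  assumes "convex_quadratic f"
  shows "continuous_on UNIV f"
proof -
  obtain A :: "real^'n^'n" and a \<alpha> where "f = (\<lambda>x. (A *v x) \<bullet> x + a \<bullet> x + \<alpha>)"
    using assms by (auto simp: convex_quadratic_def)
  moreover have "continuous_on UNIV (\<lambda>x. A *v x)"
    by (intro linear_continuous_on matrix_vector_mul_bounded_linear)
  ultimately show ?thesis
    by (auto intro!: continuous_on_add continuous_on_inner continuous_on_const continuous_on_id)
qed

text \<open>The second difference of \<open>f\<close> at \<open>x\<close> gives \<open>\<langle>Ah,h\<rangle> \<le> 0\<close>, so \<open>Ah = 0\<close> and \<open>f\<close> is affine along \<open>h\<close>
  with slope \<open>\<langle>a,h\<rangle>\<close> independent of the base point; the two signs make that slope zero.\<close>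
lemma convex_quadratic_invariance:
  fixes f :: "real^'n \<Rightarrow> real"
  assumes "convex_quadratic f" "f x = 0" "f (x + h) \<le> 0" "f (x - h) \<le> 0"
  shows "h \<in> invariance_space f"
proof -
  obtain A :: "real^'n^'n" and a \<alpha> where
    sym: "transpose A = A" and psd: "positive_semidefinite A"
    and f: "\<And>x. f x = (A *v x) \<bullet> x + a \<bullet> x + \<alpha>"
    using assms(1) by (auto simp: convex_quadratic_def)
  have sw: "(A *v y) \<bullet> z = (A *v z) \<bullet> y" for y z
    using sym by (metis dot_lmul_matrix inner_commute transpose_matrix_vector)
  have expand: "f (y + t *\<^sub>R h) = f y + t * (2 * ((A *v h) \<bullet> y) + a \<bullet> h) + t\<^sup>2 * ((A *v h) \<bullet> h)" for y t
    using sw[of y h] by (simp add: f matrix_vector_right_distrib matrix_vector_mult_scaleR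
        inner_add_left inner_add_right power2_eq_square algebra_simps)
  have plus: "2 * ((A *v h) \<bullet> x) + a \<bullet> h + (A *v h) \<bullet> h \<le> 0"
    using expand[of x 1] assms by simp
  have minus: "- (2 * ((A *v h) \<bullet> x) + a \<bullet> h) + (A *v h) \<bullet> h \<le> 0"
    using expand[of x "-1"] assms by simp
  have "(A *v h) \<bullet> h = 0"
    using plus minus psd by (auto simp: positive_semidefinite_def intro: antisym)
  with sym psd have Ah: "A *v h = 0"
    by (rule positive_semidefinite_kernel)
  have "a \<bullet> h = 0"
    using plus minus Ah by simp
  with Ah show ?thesis
    by (simp add: invariance_space_def expand)
qed

section \<open>Directions of faces\<close>

text \<open>The set \<open>A\<close> consists of the constraints active at a relative interior point of the face,
  and a direction of the face keeps each of them nonpositive on both sides of its zero. Inactive constraints hold on a whole neighbourhood of that point, hence do not restrict the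
  directions.\<close>
lemma directions_face_eq:
  fixes f :: "'i \<Rightarrow> real^'n \<Rightarrow> real"
  assumes J: "finite J" and quad: "\<And>j. j \<in> J \<Longrightarrow> convex_quadratic (f j)"
    and C: "C = {x. \<forall>j\<in>J. f j x \<le> 0}"
    and F: "F face_of C" "F \<noteq> {}"
  obtains A where "A \<subseteq> J" "directions F = directions C \<inter> (\<Inter>j\<in>A. invariance_space (f j))"
proof -
  have "F \<subseteq> C" "convex F"
    using F by (auto simp: face_of_def)
  obtain x where xr: "x \<in> rel_interior F"
    using F(2) \<open>convex F\<close> rel_interior_eq_empty by blast
  then have "x \<in> F"
    using rel_interior_subset by blast
  then have xF: "x \<in> affine hull F" and xC: "x \<in> affine hull C"
    using \<open>F \<subseteq> C\<close> by (auto simp: hull_inc)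
  define A where "A = {j\<in>J. f j x = 0}"
  have "directions F \<subseteq> directions C"
    using hull_mono[OF \<open>F \<subseteq> C\<close>] mem_directions_iff[OF xF] mem_directions_iff[OF xC] by blast
  moreover have "h \<in> invariance_space (f j)" if h: "h \<in> directions F" and j: "j \<in> A" for h j
  proof -
    obtain t where t: "t > 0" "x + t *\<^sub>R h \<in> F" "x - t *\<^sub>R h \<in> F"
      by (rule rel_interior_both_sides[OF xr h])
    then have "x + t *\<^sub>R h \<in> C" "x - t *\<^sub>R h \<in> C"
      using \<open>F \<subseteq> C\<close> by auto
    then have "t *\<^sub>R h \<in> invariance_space (f j)"
      using j by (intro convex_quadratic_invariance[of _ x] quad) (auto simp: A_def C)
    then have "(1 / t) *\<^sub>R (t *\<^sub>R h) \<in> invariance_space (f j)"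
      by (rule subspace_scale[OF subspace_invariance_space])
    with t show ?thesis
      by simp
  qed
  moreover have "h \<in> directions F" if h: "\<And>j. j \<in> A \<Longrightarrow> h \<in> invariance_space (f j)" for h
  proof (cases "h = 0")
    case True
    then show ?thesis
      by (simp add: directions_def)
  next
    case False
    have "\<forall>\<^sub>F t in at_right 0. f j (x + t *\<^sub>R h) \<le> 0 \<and> f j (x - t *\<^sub>R h) \<le> 0" if j: "j \<in> J" for j
    proof (cases "j \<in> A")
      case True
      have inv: "f j (x + t *\<^sub>R h) = 0" for t
        using h[OF True] True by (simp add: invariance_space_def A_def)
      from inv inv[of "- t" for t] show ?thesis
        by simp
    next
      case False
      then have neg: "f j x < 0"
        using j \<open>x \<in> F\<close> \<open>F \<subseteq> C\<close> by (fastforce simp: A_def C)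
      have cont: "isCont (f j) y" for y
        using convex_quadratic_continuous[OF quad[OF j]]
        by (simp add: continuous_on_eq_continuous_at)
      have "((\<lambda>t. f j (x + t *\<^sub>R h)) \<longlongrightarrow> f j x) (at_right 0)"
        by (rule isCont_tendsto_compose[OF cont]) (auto intro!: tendsto_eq_intros)
      moreover have "((\<lambda>t. f j (x - t *\<^sub>R h)) \<longlongrightarrow> f j x) (at_right 0)"
        by (rule isCont_tendsto_compose[OF cont]) (auto intro!: tendsto_eq_intros)
      ultimately show ?thesis
        using neg by (auto dest!: order_tendstoD(2) elim: eventually_elim2)
    qed
    then have "\<forall>\<^sub>F t in at_right 0. \<forall>j\<in>J. f j (x + t *\<^sub>R h) \<le> 0 \<and> f j (x - t *\<^sub>R h) \<le> 0"
      using J by (simp add: eventually_ball_finite)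
    then have "\<forall>\<^sub>F t in at_right (0::real). t > 0 \<and> x + t *\<^sub>R h \<in> C \<and> x - t *\<^sub>R h \<in> C"
      using eventually_at_right_less[of "0::real"] by eventually_elim (auto simp: C)
    then obtain t :: real where t: "t > 0" "x + t *\<^sub>R h \<in> C" "x - t *\<^sub>R h \<in> C"
      using eventually_happens'[OF trivial_limit_at_right_real] by blast
    have "(x - t *\<^sub>R h) + (x + t *\<^sub>R h) = 2 *\<^sub>R x"
      by (simp add: scaleR_2)
    then have "x = midpoint (x - t *\<^sub>R h) (x + t *\<^sub>R h)"
      by (simp add: midpoint_def)
    moreover have "(x + t *\<^sub>R h) - (x - t *\<^sub>R h) = 2 *\<^sub>R (t *\<^sub>R h)"
      by (simp only: scaleR_2 diff_diff_eq2 add.assoc add_diff_cancel_left')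
    then have "x - t *\<^sub>R h \<noteq> x + t *\<^sub>R h"
      using t False by auto
    ultimately have "x \<in> open_segment (x - t *\<^sub>R h) (x + t *\<^sub>R h)"
      by (metis midpoint_in_open_segment)
    then have "x + t *\<^sub>R h \<in> F"
      using F(1) t \<open>x \<in> F\<close> by (auto simp: face_of_def)
    then have "t *\<^sub>R h \<in> directions F"
      using mem_directions_iff[OF xF] by (simp add: hull_inc)
    then have "(1 / t) *\<^sub>R (t *\<^sub>R h) \<in> directions F"
      by (rule subspace_scale[OF subspace_directions[OF F(2)]])
    with t show ?thesis
      by simp
  qed
  ultimately have "directions F = directions C \<inter> (\<Inter>j\<in>A. invariance_space (f j))"
    by (intro equalityI subsetI IntI INT_I) auto
  then show thesis
    using that[of A] by (simp add: A_def)
qed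

section \<open>Covering the signature\<close>

text \<open>Codimensions are written as integer differences; each step of the induction is the
  dimension formula for a sum and an intersection, the sum staying inside \<open>V\<close>.\<close>
lemma codim_Inter_le_sum:
  fixes V :: "'a::euclidean_space set"
  assumes "finite A" and V: "subspace V" and L: "\<And>j. j \<in> A \<Longrightarrow> subspace (L j)"
  shows "int (dim V) - int (dim (V \<inter> (\<Inter>j\<in>A. L j))) \<le> (\<Sum>j\<in>A. int (dim V) - int (dim (V \<inter> L j)))"
  using assms(1) L
proof (induction A rule: finite_induct)
  case empty
  then show ?case
    by simp
next
  case (insert k A)
  let ?S = "V \<inter> L k" and ?T = "V \<inter> (\<Inter>j\<in>A. L j)"
  have S: "subspace ?S" and T: "subspace ?T"
    using V insert.prems by (auto intro!: subspace_inter subspace_Inter)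
  have "{x + y |x y. x \<in> ?S \<and> y \<in> ?T} \<subseteq> V"
    using V by (auto intro: subspace_add)
  then have "dim {x + y |x y. x \<in> ?S \<and> y \<in> ?T} \<le> dim V"
    by (rule dim_subset)
  moreover have "V \<inter> (\<Inter>j\<in>insert k A. L j) = ?S \<inter> ?T"
    by auto
  ultimately show ?case
    using dim_sums_Int[OF S T] insert by simp
qed

lemma ex_antimono_enumeration:
  fixes g :: "nat \<Rightarrow> int"
  obtains p where "p ` {1..K} = {..<K}" "antimono_on {1..K} (\<lambda>m. g (p m))"
proof -
  define xs where "xs = sort_key (\<lambda>j. - g j) [0..<K]"
  have len: "length xs = K" and set: "set xs = {..<K}"
    and sorted: "sorted (map (\<lambda>j. - g j) xs)"
    by (auto simp: xs_def)
  define p where "p m = xs ! (m - 1)" for m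
  have "p ` {1..K} = (!) xs ` ((\<lambda>m. m - 1) ` {1..K})"
    by (simp add: p_def image_image)
  also have "(\<lambda>m. m - 1) ` {1..K} = {..<K}"
    by (force simp: image_iff intro: bexI[of _ "Suc _"])
  also have "(!) xs ` {..<K} = {..<K}"
    using set by (simp add: set_conv_nth len image_def) (auto)
  finally have "p ` {1..K} = {..<K}" .
  moreover have "antimono_on {1..K} (\<lambda>m. g (p m))"
  proof (rule monotone_onI)
    fix l m assume "l \<in> {1..K}" "m \<in> {1..K}" "l \<le> m"
    then show "g (p m) \<le> g (p l)"
      using sorted_nth_mono[OF sorted, of "l - 1" "m - 1"] len by (simp add: p_def)
  qed
  ultimately show thesis
    by (rule that)
qed

theorem theorem1p2:
  fixes I :: "nat set" and C :: "(real^'N) set" and K :: nat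
  assumes "finite I" and "I \<noteq> {}"
    and "convex C"
    and "facial_dimension_signature C = int ` I"
    and "represented_by_convex_quadratics C K"
  shows "min_cover I \<le> K"
proof -
  obtain f where quad: "\<And>j. j < K \<Longrightarrow> convex_quadratic (f j)"
    and C: "C = {x. \<forall>j<K. f j x \<le> 0}"
    using assms(5) by (auto simp: represented_by_convex_quadratics_def)
  define V where "V = directions C"
  define n where "n = Max I"
  define L where "L j = invariance_space (f j)" for j
  have face_dim: "\<exists>F. int i = aff_dim F \<and> F face_of C \<and> F \<noteq> {}" if "i \<in> I" for i
  proof -
    have "int i \<in> facial_dimension_signature C"
      using assms(4) that by simp
    then show ?thesis
      unfolding facial_dimension_signature_def by blast
  qed
  have "C \<noteq> {}"
    using face_dim \<open>I \<noteq> {}\<close> by auto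
  then have "subspace V" and aff_dim_C: "aff_dim C = int (dim V)"
    by (simp_all add: V_def subspace_directions aff_dim_eq_dim_directions)
  have "aff_dim C \<in> facial_dimension_signature C"
    unfolding facial_dimension_signature_def
    using face_of_refl[OF \<open>convex C\<close>] \<open>C \<noteq> {}\<close> by blast
  then have "dim V \<in> I"
    using assms(4) aff_dim_C by auto
  moreover have "i \<le> dim V" if "i \<in> I" for i
    using face_dim[OF that] aff_dim_C aff_dim_subset face_of_imp_subset
    by (metis of_nat_le_iff)
  ultimately have dim_V: "dim V = n"
    unfolding n_def using \<open>finite I\<close> by (metis Max_eqI)
  obtain p where p: "p ` {1..K} = {..<K}"
    and anti: "antimono_on {1..K} (\<lambda>m. int (dim (V \<inter> L (p m))))"
    by (rule ex_antimono_enumeration[where g = "\<lambda>j. int (dim (V \<inter> L j))" and K = K])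
  define d where "d m = int (dim (V \<inter> L (p m)))" for m
  have d_le: "d m \<le> n" for m
    by (simp add: d_def dim_subset flip: dim_V)
  have quad_p: "convex_quadratic (f (p m))" if "m \<in> {1..K}" for m
    using that p by (intro quad) blast
  have "C = {x. \<forall>j\<in>p ` {1..K}. f j x \<le> 0}"
    unfolding p by (auto simp: C)
  then have C_p: "C = {x. \<forall>m\<in>{1..K}. f (p m) x \<le> 0}"
    by simp
  have "i = n \<or> (\<exists>m\<in>{1..K}. i \<in> signature_block n d m)" if "i \<in> I" for i
  proof -
    obtain F where F: "int i = aff_dim F" "F face_of C" "F \<noteq> {}"
      using face_dim[OF \<open>i \<in> I\<close>] by blast
    obtain A where A: "A \<subseteq> {1..K}"
      and dir: "directions F = V \<inter> (\<Inter>m\<in>A. L (p m))"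
      using directions_face_eq[where f = "\<lambda>m. f (p m)", OF finite_atLeastAtMost quad_p C_p F(2,3)]
      unfolding V_def L_def by blast
    have "finite A"
      using A finite_subset by blast
    have i: "i = dim (V \<inter> (\<Inter>m\<in>A. L (p m)))"
      using F aff_dim_eq_dim_directions[of F] dir by simp
    show ?thesis
    proof (cases "A = {}")
      case True
      then show ?thesis
        using i dim_V by simp
    next
      case False
      define M where "M = Max A"
      have M: "M \<in> A" "A \<subseteq> {1..M}"
        using A False \<open>finite A\<close> by (auto simp: M_def)
      have "V \<inter> (\<Inter>m\<in>A. L (p m)) \<subseteq> V \<inter> L (p M)"
        using M by blast
      then have upper: "int i \<le> d M"
        by (simp add: i d_def dim_subset)
      have "int n - int i \<le> (\<Sum>m\<in>A. int n - d m)"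
        using codim_Inter_le_sum[OF \<open>finite A\<close> \<open>subspace V\<close>, of "\<lambda>m. L (p m)"]
        by (simp add: L_def subspace_invariance_space dim_V d_def flip: i[unfolded L_def])
      also have "\<dots> \<le> (\<Sum>m=1..M. int n - d m)"
        using M d_le by (intro sum_mono2) auto
      also have "\<dots> = int M * int n - (\<Sum>m=1..M. d m)"
        by (simp add: sum_subtractf)
      finally have "i \<in> signature_block n d M"
        using upper by (simp add: signature_block_def algebra_simps)
      then show ?thesis
        using M A by blast
    qed
  qed
  then have "I \<subseteq> {n} \<union> (\<Union>m\<in>{1..K}. signature_block n d m)"
    by blast
  moreover have "antimono_on {1..K} d"
    using anti by (simp add: d_def[abs_def])
  ultimately have "coverable I K"
    unfolding coverable_def n_def by blast
  then show ?thesis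
    by (rule min_cover_least(2)[OF \<open>finite I\<close>])
qed

end
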